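(* Let $N$ be a strong negation. Let $M:[0,1]^2\to[0,1]$ be a commutative binary aggregation function with neutral element $1$. If a mapping $f:[0,1]^2\to[0,1]$ satisfies (I1), (CC), (CP($N$)) and (OP), then $G(x,y)=M(f(x,y),f(y,x))$ is a restricted equivalence function (with strong negation $N$ in (REF4)).
   Context: A strong negation is a non-increasing map $N:[0,1]\to[0,1]$ with $N(0)=1$, $N(1)=0$ and $N(N(x))=x$ for all $x$. A binary aggregation function is a map $M:[0,1]^2\to[0,1]$ with $M(0,0)=0$, $M(1,1)=1$, non-decreasing in each variable; commutative means $M(x,y)=M(y,x)$; $1$ is a neutral element if $M(x,1)=M(1,x)=x$ for all $x$. For $f:[0,1]^2\to[0,1]$: (I1) $f$ is non-increasing in the first variable; (CC) $f(x,y)=0\iff x=1,\ y=0$; (CP($N$)) $f(x,y)=f(N(y),N(x))$ for all $x,y$; (OP) $f(x,y)=1\iff x\le y$, for all $x,y$. A restricted equivalence function (REF) with strong negation $N$ is a map $F:[0,1]^2\to[0,1]$ such that for all $x,y,z\in[0,1]$: (REF1) $F(x,y)=F(y,x)$; (REF2) $F(x,y)=1\iff x=y$; (REF3) $F(x,y)=0\iff (x=1,y=0)$ or $(x=0,y=1)$; (REF4) $F(x,y)=F(N(x),N(y))$; (REF5) $F(x,z)\le F(x,y)$ if $x\le y\le z$. *)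

theory Defs
  imports Complex_Main
begin

text \<open>
  Maps on \<open>[0,1]\<close> and \<open>[0,1]\<^sup>2\<close> are represented by (curried) total functions on the reals;
  only their values on the unit interval are constrained.
\<close>

abbreviation unit_interval :: "real set" where
  "unit_interval \<equiv> {0..1}"

definition unit_map2 :: "(real \<Rightarrow> real \<Rightarrow> real) \<Rightarrow> bool" where
  "unit_map2 f \<longleftrightarrow> (\<forall>x\<in>unit_interval. \<forall>y\<in>unit_interval. f x y \<in> unit_interval)"

definition strong_negation :: "(real \<Rightarrow> real) \<Rightarrow> bool" where
  "strong_negation N \<longleftrightarrow>
     (\<forall>x\<in>unit_interval. N x \<in> unit_interval) \<and>
     antimono_on unit_interval N \<and>
     N 0 = 1 \<and> N 1 = 0 \<and>
     (\<forall>x\<in>unit_interval. N (N x) = x)"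

definition aggregation2 :: "(real \<Rightarrow> real \<Rightarrow> real) \<Rightarrow> bool" where
  "aggregation2 M \<longleftrightarrow>
     unit_map2 M \<and>
     M 0 0 = 0 \<and> M 1 1 = 1 \<and>
     (\<forall>y\<in>unit_interval. mono_on unit_interval (\<lambda>x. M x y)) \<and>
     (\<forall>x\<in>unit_interval. mono_on unit_interval (\<lambda>y. M x y))"

definition commutative2 :: "(real \<Rightarrow> real \<Rightarrow> real) \<Rightarrow> bool" where
  "commutative2 M \<longleftrightarrow> (\<forall>x\<in>unit_interval. \<forall>y\<in>unit_interval. M x y = M y x)"

definition neutral_one :: "(real \<Rightarrow> real \<Rightarrow> real) \<Rightarrow> bool" where
  "neutral_one M \<longleftrightarrow> (\<forall>x\<in>unit_interval. M x 1 = x \<and> M 1 x = x)"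

definition I1 :: "(real \<Rightarrow> real \<Rightarrow> real) \<Rightarrow> bool" where
  "I1 f \<longleftrightarrow> (\<forall>y\<in>unit_interval. antimono_on unit_interval (\<lambda>x. f x y))"

definition CC :: "(real \<Rightarrow> real \<Rightarrow> real) \<Rightarrow> bool" where
  "CC f \<longleftrightarrow> (\<forall>x\<in>unit_interval. \<forall>y\<in>unit_interval. f x y = 0 \<longleftrightarrow> x = 1 \<and> y = 0)"

definition CP :: "(real \<Rightarrow> real) \<Rightarrow> (real \<Rightarrow> real \<Rightarrow> real) \<Rightarrow> bool" where
  "CP N f \<longleftrightarrow> (\<forall>x\<in>unit_interval. \<forall>y\<in>unit_interval. f x y = f (N y) (N x))"

definition OP :: "(real \<Rightarrow> real \<Rightarrow> real) \<Rightarrow> bool" where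
  "OP f \<longleftrightarrow> (\<forall>x\<in>unit_interval. \<forall>y\<in>unit_interval. f x y = 1 \<longleftrightarrow> x \<le> y)"

definition restricted_equivalence :: "(real \<Rightarrow> real) \<Rightarrow> (real \<Rightarrow> real \<Rightarrow> real) \<Rightarrow> bool" where
  "restricted_equivalence N F \<longleftrightarrow>
     unit_map2 F \<and>
     (\<forall>x\<in>unit_interval. \<forall>y\<in>unit_interval. F x y = F y x) \<and>
     (\<forall>x\<in>unit_interval. \<forall>y\<in>unit_interval. F x y = 1 \<longleftrightarrow> x = y) \<and>
     (\<forall>x\<in>unit_interval. \<forall>y\<in>unit_interval.
        F x y = 0 \<longleftrightarrow> (x = 1 \<and> y = 0) \<or> (x = 0 \<and> y = 1)) \<and>
     (\<forall>x\<in>unit_interval. \<forall>y\<in>unit_interval. F x y = F (N x) (N y)) \<and>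
     (\<forall>x\<in>unit_interval. \<forall>y\<in>unit_interval. \<forall>z\<in>unit_interval.
        x \<le> y \<and> y \<le> z \<longrightarrow> F x z \<le> F x y)"

end

theory Submission
  imports Defs
begin

text \<open>
  Of the two values \<open>f x y\<close> and \<open>f y x\<close> at least one is \<open>1\<close>, by (OP), and \<open>1\<close> is neutral for \<open>M\<close>.
  So the aggregation only selects the other value: \<open>M (f x y) (f y x) = f (max x y) (min x y)\<close>
  (lemma \<open>aggregated_implication_eq_max_min\<close>). In this form symmetry is evident, and
  (OP), (CC) and (I1) at the pair \<open>(max x y, min x y)\<close> become (REF2), (REF3) and (REF5).
  For (REF4), contraposition exchanges the two arguments of \<open>M\<close>, and commutativity of \<open>M\<close>
  restores them.
\<close>

lemma aggregated_implication_eq_max_min: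
  assumes "neutral_one M" "unit_map2 f" "OP f"
    and "x \<in> unit_interval" "y \<in> unit_interval"
  shows "M (f x y) (f y x) = f (max x y) (min x y)"
proof (cases "x \<le> y")
  case True
  then have "f x y = 1" using assms unfolding OP_def by blast
  moreover have "f y x \<in> unit_interval" using assms unfolding unit_map2_def by blast
  ultimately show ?thesis
    using True assms(1) unfolding neutral_one_def by (simp add: max_def min_def)
next
  case False
  then have "f y x = 1" using assms unfolding OP_def by (meson linear)
  moreover have "f x y \<in> unit_interval" using assms unfolding unit_map2_def by blast
  ultimately show ?thesis
    using False assms(1) unfolding neutral_one_def by (simp add: max_def min_def)
qed

theorem theorem3p14:
  fixes N :: "real \<Rightarrow> real"
    and M f :: "real \<Rightarrow> real \<Rightarrow> real"
  assumes "strong_negation N"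
    and "aggregation2 M" and "commutative2 M" and "neutral_one M"
    and "unit_map2 f"
    and "I1 f" and "CC f" and "CP N f" and "OP f"
  shows "restricted_equivalence N (\<lambda>x y. M (f x y) (f y x))"
proof -
  let ?G = "\<lambda>x y. M (f x y) (f y x)"
  let ?I = "unit_interval"
  note G_eq = aggregated_implication_eq_max_min[OF \<open>neutral_one M\<close> \<open>unit_map2 f\<close> \<open>OP f\<close>]
  have max_min: "max x y \<in> ?I \<and> min x y \<in> ?I" if "x \<in> ?I" "y \<in> ?I" for x y
    using that by (auto simp: max_def min_def)
  have f_range: "f x y \<in> ?I" if "x \<in> ?I" "y \<in> ?I" for x y
    using \<open>unit_map2 f\<close> that unfolding unit_map2_def by blast
  have "unit_map2 ?G"
    unfolding unit_map2_def using G_eq f_range max_min by metis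
  moreover have "?G x y = ?G y x" if "x \<in> ?I" "y \<in> ?I" for x y
    using G_eq that by (simp add: max.commute min.commute)
  moreover have "?G x y = 1 \<longleftrightarrow> x = y" if "x \<in> ?I" "y \<in> ?I" for x y
  proof -
    have "?G x y = 1 \<longleftrightarrow> max x y \<le> min x y"
      using G_eq[OF that] \<open>OP f\<close> max_min[OF that] unfolding OP_def by simp
    then show ?thesis by auto
  qed
  moreover have "?G x y = 0 \<longleftrightarrow> (x = 1 \<and> y = 0) \<or> (x = 0 \<and> y = 1)"
    if "x \<in> ?I" "y \<in> ?I" for x y
  proof -
    have "?G x y = 0 \<longleftrightarrow> max x y = 1 \<and> min x y = 0"
      using G_eq[OF that] \<open>CC f\<close> max_min[OF that] unfolding CC_def by simp
    then show ?thesis by (auto simp: max_def min_def)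
  qed
  moreover have "?G x y = ?G (N x) (N y)" if "x \<in> ?I" "y \<in> ?I" for x y
  proof -
    have "f (N x) (N y) = f y x" "f (N y) (N x) = f x y"
      using \<open>CP N f\<close> that unfolding CP_def by metis+
    then show ?thesis
      using \<open>commutative2 M\<close> f_range that unfolding commutative2_def by simp
  qed
  moreover have "?G x z \<le> ?G x y"
    if "x \<in> ?I" "y \<in> ?I" "z \<in> ?I" "x \<le> y" "y \<le> z" for x y z
  proof -
    have "f z x \<le> f y x"
      using \<open>I1 f\<close> that unfolding I1_def monotone_on_def by blast
    then show ?thesis
      using G_eq that by (simp add: max_def min_def)
  qed
  ultimately show ?thesis
    unfolding restricted_equivalence_def by blast
qed

end
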